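(* Let $L$ and $s$ be positive integers and let $V \subset \{s+1, \ldots, L+s\}$ be nonempty with $t = |V| \leq \frac{L-2}{2}$. Then for all integers $N \geq (10s)^5 (t+1)^4 (39s^2t^3)^{5t}$, \[ |\{\pi \in I_{L,s,V} : |\pi| = N \}| \geq |\{\pi \in D_{L,s,V} : |\pi| = N\}|. \]
   Context: For a partition $\pi$, $|\pi|$ denotes the sum of its parts. $I_{L,s,V}$ is the set of integer partitions whose smallest part is $s$, all of whose parts are $\leq L+s$, and in which no element of $V$ appears as a part. $D_{L,s,V}$ is the set of nonempty integer partitions all of whose parts lie in $\{s+1, \ldots, L+s\}$ and such that, for each $k \in V$, the number of times $k$ appears as a part is a perfect $t$-th power, i.e. lies in $\{0, 1, 2^t, 3^t, \ldots\}$, where $t=|V|$. *)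

theory Defs
  imports Complex_Main "HOL-Library.Multiset" "HOL-Computational_Algebra.Nth_Powers"
begin

text \<open>Integer partitions are finite multisets of positive integers; the sum of the parts
  of \<open>\<pi>\<close> is \<open>\<Sum>\<^sub># \<pi>\<close> and the number of occurrences of the part \<open>k\<close> is \<open>count \<pi> k\<close>.\<close>

definition is_partition :: "nat multiset \<Rightarrow> bool" where
  "is_partition \<pi> \<longleftrightarrow> (\<forall>k \<in># \<pi>. 0 < k)"

text \<open>Having a smallest part forces a partition to be nonempty; this is stated explicitly since
  \<open>Min {}\<close> is unspecified.\<close>

definition I_parts :: "nat \<Rightarrow> nat \<Rightarrow> nat set \<Rightarrow> nat multiset set" where
  "I_parts L s V = {\<pi>. is_partition \<pi> \<and> \<pi> \<noteq> {#} \<and> Min (set_mset \<pi>) = s \<and>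
     (\<forall>k \<in># \<pi>. k \<le> L + s) \<and> (\<forall>k \<in> V. k \<notin># \<pi>)}"

definition D_parts :: "nat \<Rightarrow> nat \<Rightarrow> nat set \<Rightarrow> nat multiset set" where
  "D_parts L s V = {\<pi>. is_partition \<pi> \<and> \<pi> \<noteq> {#} \<and> set_mset \<pi> \<subseteq> {s+1..L+s} \<and>
     (\<forall>k \<in> V. is_nth_power (card V) (count \<pi> k))}"

text \<open>There are only finitely many partitions of \<open>N\<close>, so cardinalities of sets of partitions
  of \<open>N\<close> are meaningful.\<close>

lemma finite_partitions: "finite {\<pi>. is_partition \<pi> \<and> \<Sum>\<^sub># \<pi> = N}"
proof (rule finite_subset)
  show "finite (mset ` {xs. set xs \<subseteq> {..N} \<and> length xs \<le> N})"
    by (intro finite_imageI finite_lists_length_le) simp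
  show "{\<pi>. is_partition \<pi> \<and> \<Sum>\<^sub># \<pi> = N} \<subseteq> mset ` {xs. set xs \<subseteq> {..N} \<and> length xs \<le> N}"
  proof
    fix \<pi> :: "nat multiset"
    assume "\<pi> \<in> {\<pi>. is_partition \<pi> \<and> \<Sum>\<^sub># \<pi> = N}"
    then have pos: "\<forall>k \<in># \<pi>. 0 < k" and sum: "\<Sum>\<^sub># \<pi> = N"
      by (auto simp: is_partition_def)
    obtain xs where xs: "\<pi> = mset xs" by (metis ex_mset)
    have "size \<pi> \<le> \<Sum>\<^sub># \<pi>"
      using pos by (induction \<pi>) auto
    moreover have "k \<le> \<Sum>\<^sub># \<pi>" if "k \<in># \<pi>" for k
      using that by (induction \<pi>) auto
    ultimately show "\<pi> \<in> mset ` {xs. set xs \<subseteq> {..N} \<and> length xs \<le> N}"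
      using xs sum by auto
  qed
qed

corollary finite_I_parts: "finite {\<pi> \<in> I_parts L s V. \<Sum>\<^sub># \<pi> = N}"
  by (rule finite_subset[OF _ finite_partitions[of N]]) (auto simp: I_parts_def)

corollary finite_D_parts: "finite {\<pi> \<in> D_parts L s V. \<Sum>\<^sub># \<pi> = N}"
  by (rule finite_subset[OF _ finite_partitions[of N]]) (auto simp: D_parts_def)

end

theory Submission
  imports Defs "HOL-Library.FuncSet"
begin

text \<open>Since \<open>L \<ge> 2 t + 2\<close>, two consecutive numbers \<open>a, a + 1\<close> with \<open>s < a \<le> s + 2 t + 1\<close> are
  outside \<open>V\<close>. Fix the submultiset \<open>\<sigma>\<close> of parts other than \<open>s\<close>, \<open>a\<close>, \<open>a + 1\<close> and the elements
  of \<open>V\<close>, and let \<open>n = N - \<Sum>\<^sub># \<sigma>\<close>. As \<open>y\<close> has about \<open>y / (a (a + 1))\<close> partitions into parts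
  \<open>a\<close> and \<open>a + 1\<close>, and the \<open>V\<close>-parts can be chosen with sum at most \<open>y\<close> in about at most
  \<open>y / (s + 1)\<close> ways as opposed to the \<open>y / s\<close> choices of copies of \<open>s\<close>, the number of
  completions of \<open>\<sigma>\<close> on the \<open>I\<close>-side exceeds that on the \<open>D\<close>-side by at least a quadratic
  polynomial in \<open>n\<close> with positive leading coefficient. The few losses, for small \<open>n\<close>, are
  compensated by the surplus at a smaller \<open>\<sigma>\<close>, obtained by removing one large part or many
  copies of one small part.\<close>

section \<open>Multisets with parts in a given set\<close>

definition parts_in :: "nat set \<Rightarrow> nat multiset set" where
  "parts_in A = {\<pi>. set_mset \<pi> \<subseteq> A}"

lemma finite_parts_in_sum_le:
  assumes "0 \<notin> A"
  shows "finite {\<pi> \<in> parts_in A. \<Sum>\<^sub># \<pi> \<le> n}"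
proof (rule finite_subset)
  show "{\<pi> \<in> parts_in A. \<Sum>\<^sub># \<pi> \<le> n} \<subseteq> (\<Union>m\<le>n. {\<pi>. is_partition \<pi> \<and> \<Sum>\<^sub># \<pi> = m})"
    using assms by (force simp: parts_in_def is_partition_def intro!: gr0I)
qed (simp add: finite_partitions)

lemma finite_parts_in_sum_eq:
  assumes "0 \<notin> A"
  shows "finite {\<pi> \<in> parts_in A. \<Sum>\<^sub># \<pi> = n}"
  by (rule finite_subset[OF _ finite_parts_in_sum_le[OF assms, of n]]) auto

lemma add_parts_in_disjoint_cancel:
  assumes "A \<inter> B = {}" "x \<in> parts_in A" "x' \<in> parts_in A" "y \<in> parts_in B" "y' \<in> parts_in B"
    and "x + y = x' + y'"
  shows "x = x' \<and> y = y'"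
proof -
  have A: "filter_mset (\<lambda>k. k \<in> A) z = z" if "z \<in> parts_in A" for z
    using that by (auto simp: parts_in_def filter_mset_eq_conv)
  have B: "filter_mset (\<lambda>k. k \<in> A) z = {#}" if "z \<in> parts_in B" for z
    using that assms(1) by (auto simp: parts_in_def filter_mset_eq_conv)
  have "x = x'"
    using A[OF assms(2)] A[OF assms(3)] B[OF assms(4)] B[OF assms(5)] assms(6)
    by (metis add.right_neutral filter_union_mset)
  then show ?thesis using assms(6) by simp
qed

text \<open>A multiset splits uniquely into its parts in disjoint sets, so counting by the first
  component gives a convolution. This is used on two levels: to separate a remainder \<sigma> from
  its completion, and to separate the parts \<open>a\<close>, \<open>a + 1\<close> inside a
  completion. Excluding 0 makes the sets finite.\<close>

lemma card_sum_split:
  assumes AB: "A \<inter> B = {}" and 0: "0 \<notin> A" "0 \<notin> B"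
    and X: "X \<subseteq> parts_in A" and Y: "Y \<subseteq> parts_in B"
  shows "card {\<pi>. \<exists>x\<in>X. \<exists>y\<in>Y. \<pi> = x + y \<and> \<Sum>\<^sub># \<pi> = n} =
    (\<Sum>x | x \<in> X \<and> \<Sum>\<^sub># x \<le> n. card {y \<in> Y. \<Sum>\<^sub># y = n - \<Sum>\<^sub># x})"
proof -
  let ?S = "SIGMA x : {x \<in> X. \<Sum>\<^sub># x \<le> n}. {y \<in> Y. \<Sum>\<^sub># y = n - \<Sum>\<^sub># x}"
  have fin: "finite {x \<in> X. \<Sum>\<^sub># x \<le> n}"
    by (rule finite_subset[OF _ finite_parts_in_sum_le[OF 0(1), of n]]) (use X in auto)
  have "finite {y \<in> Y. \<Sum>\<^sub># y = m}" for m
    by (rule finite_subset[OF _ finite_parts_in_sum_eq[OF 0(2), of m]]) (use Y in auto)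
  then have "card ?S = (\<Sum>x | x \<in> X \<and> \<Sum>\<^sub># x \<le> n. card {y \<in> Y. \<Sum>\<^sub># y = n - \<Sum>\<^sub># x})"
    using fin by (subst card_SigmaI) auto
  moreover have "inj_on (\<lambda>(x, y). x + y) ?S"
  proof (rule inj_onI, clarify)
    fix x y x' y' assume "x \<in> X" "y \<in> Y" "x' \<in> X" "y' \<in> Y" "x + y = x' + y'"
    then show "x = x' \<and> y = y'"
      using X Y by (intro add_parts_in_disjoint_cancel[OF AB]) auto
  qed
  moreover have "(\<lambda>(x, y). x + y) ` ?S = {\<pi>. \<exists>x\<in>X. \<exists>y\<in>Y. \<pi> = x + y \<and> \<Sum>\<^sub># \<pi> = n}"
    by (force simp: image_iff)
  ultimately show ?thesis using card_image[of "\<lambda>(x, y). x + y" ?S] by simp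
qed

lemma mset_eq_sum_replicate:
  assumes "finite A" "set_mset \<pi> \<subseteq> A"
  shows "\<pi> = (\<Sum>k\<in>A. replicate_mset (count \<pi> k) k)"
proof (rule multiset_eqI)
  fix x
  have "count (\<Sum>k\<in>A. replicate_mset (count \<pi> k) k) x = (\<Sum>k\<in>A. if k = x then count \<pi> k else 0)"
    by (auto simp: count_sum intro!: sum.cong)
  also have "\<dots> = count \<pi> x"
    using assms by (auto simp: sum.delta not_in_iff)
  finally show "count \<pi> x = count (\<Sum>k\<in>A. replicate_mset (count \<pi> k) k) x" ..
qed

lemma sum_mset_eq_sum_count:
  fixes \<pi> :: "nat multiset"
  assumes "finite A" "set_mset \<pi> \<subseteq> A"
  shows "\<Sum>\<^sub># \<pi> = (\<Sum>k\<in>A. count \<pi> k * k)"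
proof -
  have "\<Sum>\<^sub># (\<Sum>k\<in>A. f k) = (\<Sum>k\<in>A. \<Sum>\<^sub># (f k))" for f :: "nat \<Rightarrow> nat multiset"
    using assms(1) by (induction A) auto
  moreover have "\<Sum>\<^sub># \<pi> = \<Sum>\<^sub># (\<Sum>k\<in>A. replicate_mset (count \<pi> k) k)"
    using mset_eq_sum_replicate[OF assms] by (rule arg_cong)
  ultimately show ?thesis by simp
qed

lemma count_mult_le_sum_mset:
  fixes \<pi> :: "nat multiset"
  shows "count \<pi> k * k \<le> \<Sum>\<^sub># \<pi>"
proof (cases "k \<in># \<pi>")
  case True
  then show ?thesis
    by (subst sum_mset_eq_sum_count[of "set_mset \<pi>"])
      (auto intro!: member_le_sum[of k _ "\<lambda>k. count \<pi> k * k"])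
qed (simp add: not_in_iff)

section \<open>Partitions into two consecutive parts\<close>

text \<open>The number of parts equal to a + 1 is congruent to y mod a, so its quotient by a
  determines the whole partition. This quotient is at most y div (a(a + 1)).\<close>

lemma card_consecutive_parts_upper:
  assumes "a > 0"
  shows "a * (a + 1) * card {\<pi> \<in> parts_in {a, a + 1}. \<Sum>\<^sub># \<pi> = y} \<le> y + a * (a + 1)"
proof -
  let ?Q = "{\<pi> \<in> parts_in {a, a + 1}. \<Sum>\<^sub># \<pi> = y}"
  have sum: "count \<pi> a * a + count \<pi> (a + 1) * (a + 1) = y" if "\<pi> \<in> ?Q" for \<pi>
    using that sum_mset_eq_sum_count[of "{a, a + 1}" \<pi>] by (auto simp: parts_in_def)
  have mod: "count \<pi> (a + 1) mod a = y mod a" if "\<pi> \<in> ?Q" for \<pi>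
  proof -
    have "y = count \<pi> (a + 1) + a * (count \<pi> a + count \<pi> (a + 1))"
      using sum[OF that] by (simp add: algebra_simps)
    then show ?thesis by simp
  qed
  have inj: "inj_on (\<lambda>\<pi>. count \<pi> (a + 1) div a) ?Q"
  proof (rule inj_onI)
    fix \<pi> \<rho> assume \<pi>: "\<pi> \<in> ?Q" and \<rho>: "\<rho> \<in> ?Q"
      and "count \<pi> (a + 1) div a = count \<rho> (a + 1) div a"
    then have 1: "count \<pi> (a + 1) = count \<rho> (a + 1)"
      using mod[OF \<pi>] mod[OF \<rho>] by (metis div_mult_mod_eq)
    then have "count \<pi> a * a = count \<rho> a * a"
      using sum[OF \<pi>] sum[OF \<rho>] by (metis add_right_cancel)
    then have "count \<pi> a = count \<rho> a" using assms by simp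
    moreover have "\<pi> = (\<Sum>k\<in>{a, a+1}. replicate_mset (count \<pi> k) k)"
      "\<rho> = (\<Sum>k\<in>{a, a+1}. replicate_mset (count \<rho> k) k)"
      by (rule mset_eq_sum_replicate; use \<pi> \<rho> in \<open>auto simp: parts_in_def\<close>)+
    ultimately show "\<pi> = \<rho>" using 1 by simp
  qed
  have "(\<lambda>\<pi>. count \<pi> (a + 1) div a) ` ?Q \<subseteq> {..y div (a * (a + 1))}"
  proof (intro image_subsetI)
    fix \<pi> assume "\<pi> \<in> ?Q"
    then have "count \<pi> (a + 1) * (a + 1) \<le> y"
      by (metis (mono_tags, lifting) count_mult_le_sum_mset mem_Collect_eq)
    then have "count \<pi> (a + 1) \<le> y div (a + 1)"
      by (simp add: less_eq_div_iff_mult_less_eq)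
    then show "count \<pi> (a + 1) div a \<in> {..y div (a * (a + 1))}"
      by (metis atMost_iff div_le_mono div_mult2_eq mult.commute)
  qed
  then have "card ?Q \<le> y div (a * (a + 1)) + 1"
    using card_inj_on_le[OF inj, of "{..y div (a * (a + 1))}"] by simp
  then have "a * (a + 1) * card ?Q \<le> a * (a + 1) * (y div (a * (a + 1)) + 1)"
    by (rule mult_le_mono2)
  also have "\<dots> = a * (a + 1) * (y div (a * (a + 1))) + a * (a + 1)"
    by (simp add: algebra_simps)
  also have "\<dots> \<le> y + a * (a + 1)"
    using times_div_less_eq_dividend[of "a * (a + 1)" y] by linarith
  finally show ?thesis .
qed

text \<open>Conversely, r + al copies of a + 1 with r = y mod a leave a multiple of a, which is
  filled by copies of a. If l < y div (a(a + 1)), these copies fit, since (a + 1)(r + al) <= a(a +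
  1)(l + 1) <= y.\<close>

lemma card_consecutive_parts_lower:
  assumes "a > 0"
  shows "y \<le> a * (a + 1) * card {\<pi> \<in> parts_in {a, a + 1}. \<Sum>\<^sub># \<pi> = y} + a * (a + 1)"
proof -
  let ?Q = "{\<pi> \<in> parts_in {a, a + 1}. \<Sum>\<^sub># \<pi> = y}"
  let ?P = "a * (a + 1)"
  define r where "r = y mod a"
  define f where "f l = replicate_mset ((y - (a + 1) * (r + a * l)) div a) a
    + replicate_mset (r + a * l) (a + 1)" for l
  have r: "r < a" unfolding r_def using assms by simp
  have f: "f l \<in> ?Q" if "l < y div ?P" for l
  proof -
    have "?P * (l + 1) \<le> ?P * (y div ?P)" using that by (intro mult_le_mono2) simp
    then have "?P * (l + 1) \<le> y" using times_div_less_eq_dividend le_trans by blast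
    moreover have "(a + 1) * r \<le> (a + 1) * a" using r by (intro mult_le_mono2) simp
    ultimately have le: "(a + 1) * (r + a * l) \<le> y" by (simp add: algebra_simps)
    have "y = a * (y div a) + r" unfolding r_def by simp
    then have "y - (a + 1) * (r + a * l) = a * (y div a) - a * (r + (a + 1) * l)"
      by (simp add: algebra_simps)
    then have "a dvd y - (a + 1) * (r + a * l)" by (metis diff_mult_distrib2 dvd_triv_left)
    then have "(y - (a + 1) * (r + a * l)) div a * a = y - (a + 1) * (r + a * l)" by simp
    then have "\<Sum>\<^sub># (f l) = y"
      using le unfolding f_def by (simp add: algebra_simps)
    then show ?thesis by (auto simp: f_def parts_in_def split: if_splits)
  qed
  have "inj_on f {..<y div ?P}"
  proof (rule inj_onI)
    fix l l' assume "f l = f l'"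
    then have "count (f l) (a + 1) = count (f l') (a + 1)" by simp
    then show "l = l'" using assms by (simp add: f_def)
  qed
  then have "y div ?P \<le> card ?Q"
    using card_inj_on_le[of f "{..<y div ?P}" ?Q] f finite_parts_in_sum_eq[of "{a, a+1}" y] assms
    by auto
  then have "?P * (y div ?P) \<le> ?P * card ?Q" by (rule mult_le_mono2)
  moreover have "y = ?P * (y div ?P) + y mod ?P" by simp
  moreover have "y mod ?P < ?P" using assms by simp
  ultimately show ?thesis by linarith
qed

section \<open>Parts occurring a perfect power number of times\<close>

definition power_parts :: "nat \<Rightarrow> nat set \<Rightarrow> nat multiset set" where
  "power_parts t V = {\<tau> \<in> parts_in V. \<forall>k\<in>V. is_nth_power t (count \<tau> k)}"

text \<open>If k occurs j^t times, then j^t (s + 1) <= y, so j takes at most z + 1 values for each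
  of the t elements of V. Because t is both the exponent and the size of V, the bound is linear in y
  up to the rounding of the root.\<close>

lemma card_power_parts_le_root:
  assumes V: "finite V" "card V = t" "t > 0" "\<And>k. k \<in> V \<Longrightarrow> s < k"
  shows "card {\<tau> \<in> power_parts t V. \<Sum>\<^sub># \<tau> \<le> y} \<le> (nth_root_nat t (y div (s + 1)) + 1) ^ t"
proof -
  define z where "z = nth_root_nat t (y div (s + 1))"
  let ?F = "Pi\<^sub>E V (\<lambda>_. {..z})"
  define f where "f j = (\<Sum>k\<in>V. replicate_mset (j k ^ t) k)" for j :: "nat \<Rightarrow> nat"
  have "{\<tau> \<in> power_parts t V. \<Sum>\<^sub># \<tau> \<le> y} \<subseteq> f ` ?F"
  proof safe
    fix \<tau> assume \<tau>: "\<tau> \<in> power_parts t V" "\<Sum>\<^sub># \<tau> \<le> y"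
    then have "\<forall>k\<in>V. \<exists>j. count \<tau> k = j ^ t" by (auto simp: power_parts_def is_nth_power_def)
    then obtain j where j: "count \<tau> k = j k ^ t" if "k \<in> V" for k by metis
    have "j k \<le> z" if "k \<in> V" for k
    proof -
      have "j k ^ t * (s + 1) \<le> j k ^ t * k"
        using V(4)[OF that] by (intro mult_le_mono2) simp
      also have "\<dots> \<le> y"
        using count_mult_le_sum_mset[of \<tau> k] \<tau>(2) j[OF that] by simp
      finally have "j k ^ t \<le> y div (s + 1)" by (simp add: less_eq_div_iff_mult_less_eq)
      then show ?thesis unfolding z_def using V(3) by (intro nth_root_nat_ge) auto
    qed
    then have "restrict j V \<in> ?F" by auto
    moreover have "\<tau> = f (restrict j V)"
      using mset_eq_sum_replicate[of V \<tau>] \<tau>(1) V(1) j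
      by (simp add: f_def power_parts_def parts_in_def)
    ultimately show "\<tau> \<in> f ` ?F" by blast
  qed
  then have "card {\<tau> \<in> power_parts t V. \<Sum>\<^sub># \<tau> \<le> y} \<le> card ?F"
    using V(1) by (intro surj_card_le) (auto intro: finite_PiE)
  also have "\<dots> = (z + 1) ^ t" using V by (simp add: card_PiE)
  finally show ?thesis unfolding z_def .
qed

text \<open>Passing from \<open>z\<close> to \<open>z + 1\<close> costs at most half of the gap between \<open>1 / (s + 1)\<close> and
  \<open>1 / s\<close> once \<open>z + 1 \<ge> t (2 s + 1)\<close>.\<close>

lemma Suc_power_le_Bernoulli:
  fixes s t z :: nat
  assumes "t * (2 * s + 1) \<le> z + 1"
  shows "2 * s * (z + 1) ^ t \<le> (2 * s + 1) * z ^ t"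
proof -
  \<comment> \<open>Bernoulli bounds (z/(z + 1))^t below by 1 - t/(z + 1), and the assumption makes
    this at least 2s/(2s + 1).\<close>
  have "1 + real t * (- 1 / (real z + 1)) \<le> (1 + (- 1 / (real z + 1))) ^ t"
    by (rule Bernoulli_inequality) (simp add: field_simps)
  also have "1 + (- 1 / (real z + 1)) = real z / (real z + 1)" by (simp add: field_simps)
  finally have "1 - real t / (real z + 1) \<le> real z ^ t / (real z + 1) ^ t"
    by (simp add: power_divide)
  moreover have "real t * (2 * real s + 1) \<le> real z + 1"
    using assms by (metis (mono_tags, lifting) of_nat_1 of_nat_add of_nat_le_iff of_nat_mult of_nat_numeral)
  then have "2 * real s / (2 * real s + 1) \<le> 1 - real t / (real z + 1)"
    by (simp add: field_simps)
  ultimately have "2 * real s / (2 * real s + 1) \<le> real z ^ t / (real z + 1) ^ t" by linarith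
  then have "2 * real s * (real z + 1) ^ t \<le> (2 * real s + 1) * real z ^ t"
    by (simp add: divide_simps add_pos_nonneg mult.commute split: if_splits)
  then have "real (2 * s * (z + 1) ^ t) \<le> real ((2 * s + 1) * z ^ t)"
    by (simp only: of_nat_mult of_nat_power of_nat_add of_nat_numeral of_nat_1)
  then show ?thesis by (simp only: of_nat_le_iff)
qed

text \<open>The slope (2s + 1)/(2s(s + 1)) is the midpoint of 1/(s + 1) and 1/s, so it stays below
  the slope 1/s of the copies of s. The additive constant covers those y whose root z is too small
  for the Bernoulli estimate.\<close>

lemma card_power_parts_le:
  assumes V: "finite V" "card V = t" "t > 0" "\<And>k. k \<in> V \<Longrightarrow> s < k"
  shows "2 * s * (s + 1) * card {\<tau> \<in> power_parts t V. \<Sum>\<^sub># \<tau> \<le> y}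
    \<le> (2 * s + 1) * (y + (s + 1) * (t * (2 * s + 1)) ^ t)"
proof -
  define z where "z = nth_root_nat t (y div (s + 1))"
  let ?A = "card {\<tau> \<in> power_parts t V. \<Sum>\<^sub># \<tau> \<le> y}"
  have A: "?A \<le> (z + 1) ^ t" unfolding z_def by (rule card_power_parts_le_root[OF V])
  show ?thesis
  proof (cases "t * (2 * s + 1) \<le> z + 1")
    case True
    have "z ^ t \<le> y div (s + 1)" unfolding z_def using V(3) by (intro nth_root_nat_power_le) auto
    then have z: "z ^ t * (s + 1) \<le> y" by (simp add: less_eq_div_iff_mult_less_eq)
    have "2 * s * (s + 1) * ?A \<le> 2 * s * (s + 1) * (z + 1) ^ t"
      using A by (rule mult_le_mono2)
    also have "\<dots> = (s + 1) * (2 * s * (z + 1) ^ t)" by (simp only: ac_simps)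
    also have "\<dots> \<le> (s + 1) * ((2 * s + 1) * z ^ t)"
      using Suc_power_le_Bernoulli[OF True] by (rule mult_le_mono2)
    also have "\<dots> = (2 * s + 1) * (z ^ t * (s + 1))" by (simp only: ac_simps)
    also have "\<dots> \<le> (2 * s + 1) * (y + (s + 1) * (t * (2 * s + 1)) ^ t)"
      using z by (intro mult_le_mono2) simp
    finally show ?thesis .
  next
    case False
    then have "(z + 1) ^ t \<le> (t * (2 * s + 1)) ^ t" by (intro power_mono) auto
    then have "?A \<le> (t * (2 * s + 1)) ^ t" using A by simp
    then have "2 * s * (s + 1) * ?A \<le> (2 * s + 1) * (s + 1) * (t * (2 * s + 1)) ^ t"
      by (intro mult_le_mono) auto
    also have "\<dots> \<le> (2 * s + 1) * (y + (s + 1) * (t * (2 * s + 1)) ^ t)"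
      by (simp add: algebra_simps)
    finally show ?thesis .
  qed
qed

section \<open>Counting for a fixed remainder\<close>

text \<open>Both sides count the pairs (x, y) with f x <= y < n. This summation by parts brings in
  the counting function that \<open>card_power_parts_le\<close> controls.\<close>

lemma sum_diff_eq_sum_card:
  fixes f :: "'a \<Rightarrow> nat"
  assumes "finite {x \<in> X. f x \<le> n}"
  shows "(\<Sum>x | x \<in> X \<and> f x \<le> n. n - f x) = (\<Sum>y<n. card {x \<in> X. f x \<le> y})"
proof -
  let ?X = "{x \<in> X. f x \<le> n}"
  have "(\<Sum>x\<in>?X. n - f x) = (\<Sum>x\<in>?X. \<Sum>y<n. if f x \<le> y then 1 else 0)"
  proof (rule sum.cong[OF refl])
    fix x assume "x \<in> ?X"
    have "(\<Sum>y<n. if f x \<le> y then 1 else 0) = card {y. y < n \<and> f x \<le> y}"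
      by (simp add: sum.If_cases Int_def)
    also have "{y. y < n \<and> f x \<le> y} = {f x..<n}" by auto
    finally show "n - f x = (\<Sum>y<n. if f x \<le> y then 1 else 0)" by simp
  qed
  also have "\<dots> = (\<Sum>y<n. \<Sum>x\<in>?X. if f x \<le> y then 1 else 0)" by (rule sum.swap)
  also have "\<dots> = (\<Sum>y<n. card {x \<in> X. f x \<le> y})"
  proof (rule sum.cong[OF refl])
    fix y assume "y \<in> {..<n}"
    then have "?X \<inter> {x. f x \<le> y} = {x \<in> X. f x \<le> y}" by auto
    then show "(\<Sum>x\<in>?X. if f x \<le> y then 1 else 0) = card {x \<in> X. f x \<le> y}"
      using assms by (simp add: sum.If_cases)
  qed
  finally show ?thesis .
qed

text \<open>A choice \<tau> of V-parts has at most (n - sum \<tau>)/P + 1 completions. After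
  summation by parts only the number of \<tau> with sum at most y matters, and it is bounded
  linearly in y. The leading coefficient becomes (2s + 1)/(4s(s + 1)P).\<close>

lemma card_power_parts_consecutive_le:
  fixes s t a n :: nat and V :: "nat set"
  defines "x\<^sub>0 \<equiv> (s + 1) * (t * (2 * s + 1)) ^ t" and "P \<equiv> a * (a + 1)"
  assumes V: "finite V" "card V = t" "t > 0" "\<And>k. k \<in> V \<Longrightarrow> s < k"
    and a: "a > 0" "a \<notin> V" "a + 1 \<notin> V"
  shows "4 * s * (s + 1) * P *
      card {\<pi>. \<exists>\<tau>\<in>power_parts t V. \<exists>\<rho>\<in>parts_in {a, a + 1}. \<pi> = \<tau> + \<rho> \<and> \<Sum>\<^sub># \<pi> = n}
    \<le> (2 * s + 1) * (n ^ 2 + 2 * x\<^sub>0 * n + 2 * P * n + 2 * P * x\<^sub>0)"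
    (is "_ * card ?D \<le> _")
proof -
  let ?X = "{\<tau> \<in> power_parts t V. \<Sum>\<^sub># \<tau> \<le> n}"
  let ?A = "\<lambda>y. card {\<tau> \<in> power_parts t V. \<Sum>\<^sub># \<tau> \<le> y}"
  have 0: "0 \<notin> V" using V(4) by blast
  have fin: "finite ?X"
    by (rule finite_subset[OF _ finite_parts_in_sum_le[OF 0, of n]]) (auto simp: power_parts_def)
  have "card ?D = (\<Sum>\<tau>\<in>?X. card {\<rho> \<in> parts_in {a, a + 1}. \<Sum>\<^sub># \<rho> = n - \<Sum>\<^sub># \<tau>})"
    using a 0 by (intro card_sum_split[of V "{a, a + 1}"]) (auto simp: power_parts_def)
  then have "P * card ?D = (\<Sum>\<tau>\<in>?X. P * card {\<rho> \<in> parts_in {a, a + 1}. \<Sum>\<^sub># \<rho> = n - \<Sum>\<^sub># \<tau>})"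
    by (simp only: sum_distrib_left)
  also have "\<dots> \<le> (\<Sum>\<tau>\<in>?X. (n - \<Sum>\<^sub># \<tau>) + P)"
    unfolding P_def by (intro sum_mono card_consecutive_parts_upper a)
  also have "\<dots> = (\<Sum>y<n. ?A y) + P * ?A n"
    unfolding sum.distrib sum_diff_eq_sum_card[OF fin] by simp
  finally have PD: "P * card ?D \<le> (\<Sum>y<n. ?A y) + P * ?A n" .
  have A: "2 * s * (s + 1) * ?A y \<le> (2 * s + 1) * (y + x\<^sub>0)" for y
    unfolding x\<^sub>0_def by (rule card_power_parts_le[OF V])
  have sq: "2 * (\<Sum>y<n. y + x\<^sub>0) \<le> n ^ 2 + 2 * x\<^sub>0 * n"
    by (induction n) (simp_all add: power2_eq_square)
  have four: "4 * s * (s + 1) * P * C = 2 * (2 * s * (s + 1) * (P * C))" for C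
    by (simp add: algebra_simps)
  have "2 * s * (s + 1) * (P * card ?D) \<le> 2 * s * (s + 1) * ((\<Sum>y<n. ?A y) + P * ?A n)"
    using PD by (rule mult_le_mono2)
  also have "\<dots> = (\<Sum>y<n. 2 * s * (s + 1) * ?A y) + P * (2 * s * (s + 1) * ?A n)"
    by (simp only: distrib_left sum_distrib_left ac_simps)
  also have "\<dots> \<le> (\<Sum>y<n. (2 * s + 1) * (y + x\<^sub>0)) + P * ((2 * s + 1) * (n + x\<^sub>0))"
    by (intro add_mono sum_mono mult_le_mono2 A)
  also have "\<dots> = (2 * s + 1) * ((\<Sum>y<n. y + x\<^sub>0) + P * (n + x\<^sub>0))"
    unfolding sum_distrib_left[symmetric] by (simp only: ring_distribs ac_simps)
  finally have "2 * (2 * s * (s + 1) * (P * card ?D))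
      \<le> 2 * ((2 * s + 1) * ((\<Sum>y<n. y + x\<^sub>0) + P * (n + x\<^sub>0)))"
    by (rule mult_le_mono2)
  also have "\<dots> = (2 * s + 1) * (2 * (\<Sum>y<n. y + x\<^sub>0) + 2 * P * (n + x\<^sub>0))"
    by (simp only: ring_distribs ac_simps)
  also have "\<dots> \<le> (2 * s + 1) * (n ^ 2 + 2 * x\<^sub>0 * n + 2 * P * (n + x\<^sub>0))"
    using sq by (intro mult_le_mono2 add_mono) auto
  also have "2 * P * (n + x\<^sub>0) = 2 * P * n + 2 * P * x\<^sub>0" by (rule distrib_left)
  finally show ?thesis by (simp only: four add.assoc)
qed

text \<open>With m copies of s, at least (n - ms)/P - 1 completions exist. Summing this arithmetic
  progression over 1 <= m <= n div s gives n^2/(2sP) up to a linear error.\<close>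

lemma card_copies_consecutive_ge:
  fixes s a n :: nat
  defines "P \<equiv> a * (a + 1)"
  assumes "0 < s" "s < a"
  shows "n ^ 2 \<le> 2 * s * P * card {\<pi>. \<exists>x\<in>{replicate_mset m s | m. m \<ge> 1}.
      \<exists>\<rho>\<in>parts_in {a, a + 1}. \<pi> = x + \<rho> \<and> \<Sum>\<^sub># \<pi> = n} + 2 * n * (P + s)"
    (is "_ \<le> _ * card ?I + _")
proof -
  define M where "M = n div s"
  let ?X = "{x \<in> {replicate_mset m s | m. m \<ge> 1}. \<Sum>\<^sub># x \<le> n}"
  let ?q = "\<lambda>y. card {\<rho> \<in> parts_in {a, a + 1}. \<Sum>\<^sub># \<rho> = y}"
  have X: "?X = (\<lambda>m. replicate_mset m s) ` {1..M}"
    using assms by (auto simp: M_def less_eq_div_iff_mult_less_eq)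
  have "card ?I = (\<Sum>x\<in>?X. ?q (n - \<Sum>\<^sub># x))"
    using assms by (intro card_sum_split[of "{s}" "{a, a + 1}"])
      (auto simp: parts_in_def split: if_splits)
  also have "\<dots> = (\<Sum>m=1..M. ?q (n - m * s))"
    unfolding X by (subst sum.reindex) (auto intro!: inj_onI dest: arg_cong[of _ _ size])
  finally have "real P * card ?I + real P * M = (\<Sum>m=1..M. real (P * ?q (n - m * s) + P))"
    by (simp add: sum.distrib sum_distrib_left)
  also have "\<dots> \<ge> (\<Sum>m=1..M. real n - real m * real s)"
  proof (rule sum_mono)
    fix m assume "m \<in> {1..M}"
    then have "m * s \<le> n"
      using assms by (simp add: M_def less_eq_div_iff_mult_less_eq)
    then have "real n - real m * real s = real (n - m * s)" by (simp add: of_nat_diff)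
    also have "\<dots> \<le> real (P * ?q (n - m * s) + P)"
      unfolding P_def of_nat_le_iff using assms by (intro card_consecutive_parts_lower) simp
    finally show "real n - real m * real s \<le> real (P * ?q (n - m * s) + P)" .
  qed
  finally have PM: "real P * card ?I + real P * M \<ge> (\<Sum>m=1..M. real n - real m * real s)" .
  have "2 * (\<Sum>m=1..k. real n - real m * real s) = 2 * k * n - real s * k * (k + 1)" for k
    by (induction k) (simp_all add: algebra_simps)
  then have "2 * M * n - real s * M * (real M + 1) = 2 * (\<Sum>m=1..M. real n - real m * real s)"
    by (rule sym)
  also have "\<dots> \<le> 2 * (real P * card ?I + real P * M)"
    using PM by (rule mult_left_mono) simp
  finally have "2 * (real P * card ?I + real P * M) \<ge> 2 * M * n - real s * M * (real M + 1)" .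
  then have "real s * (2 * (real P * card ?I + real P * M)) \<ge> real s * (2 * M * n - real s * M * (real M + 1))"
    by (intro mult_left_mono) auto
  \<comment> \<open>\<open>w\<close> is n rounded down to a multiple of s, so 0 <= n - w <= s.
    Below, w(2n - 2P - w - s) exceeds n^2 - 2n(P + s) by 2P(n - w) + (2ns - ws - (n - w)^2), which
    is nonnegative since ws <= ns and (n - w)^2 <= ns.\<close>
  moreover define w where "w = real s * M"
  ultimately have PI: "2 * s * real P * card ?I \<ge> w * (2 * real n - 2 * real P - w - s)"
    by (simp add: algebra_simps)
  have "n = s * M + n mod s" unfolding M_def by simp
  then have "real n = w + real (n mod s)" unfolding w_def by (metis of_nat_add of_nat_mult)
  moreover have "n mod s < s" using assms by simp
  ultimately have w: "w \<le> n" "n - w \<le> s" "0 \<le> w" unfolding w_def by auto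
  have "(n - w) * (n - w) \<le> real s * real n" using w by (intro mult_mono) auto
  moreover have "w * s \<le> real n * real s" using w by (intro mult_right_mono) auto
  moreover have "0 \<le> 2 * real P * (n - w)" using w by simp
  moreover have "w * (2 * real n - 2 * real P - w - s) =
      real n ^ 2 - 2 * n * (P + s) + (2 * real P * (n - w) + (2 * (real n * real s) - w * s - (n - w) * (n - w)))"
    by (simp add: algebra_simps power2_eq_square)
  ultimately have "w * (2 * real n - 2 * real P - w - s) \<ge> real n ^ 2 - 2 * n * (P + s)"
    by (simp add: mult.commute)
  with PI have "real n ^ 2 \<le> real (2 * s) * real P * card ?I + real (2 * n * (P + s))" by linarith
  then have "real (n ^ 2) \<le> real (2 * s * P * card ?I + 2 * n * (P + s))" by simp
  then show ?thesis by (simp only: of_nat_le_iff)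
qed

section \<open>Summation over the remainders\<close>

text \<open>Pigeonhole: at most R distinct values occur, and if each contributed less than R, the
  sum would not exceed R^2.\<close>

lemma exists_heavy_part:
  fixes \<sigma> :: "nat multiset"
  assumes "\<And>w. w \<in># \<sigma> \<Longrightarrow> w < R" and "R ^ 2 < \<Sum>\<^sub># \<sigma>"
  obtains w where "w \<in># \<sigma>" "R \<le> count \<sigma> w * w"
proof -
  have "\<exists>w. w \<in># \<sigma> \<and> R \<le> count \<sigma> w * w"
  proof (rule ccontr)
    assume "\<nexists>w. w \<in># \<sigma> \<and> R \<le> count \<sigma> w * w"
    then have "(\<Sum>w\<in>set_mset \<sigma>. count \<sigma> w * w) \<le> (\<Sum>w\<in>set_mset \<sigma>. R)"
      by (intro sum_mono) force
    also have "\<dots> = card (set_mset \<sigma>) * R" by simp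
    also have "\<dots> \<le> R * R"
      using card_mono[of "{..<R}" "set_mset \<sigma>"] assms(1) by (intro mult_le_mono1) auto
    finally have "\<Sum>\<^sub># \<sigma> \<le> R ^ 2"
      using sum_mset_eq_sum_count[of "set_mset \<sigma>" \<sigma>] by (simp add: power2_eq_square)
    with assms(2) show False by simp
  qed
  with that show ?thesis by blast
qed

text \<open>Each remainder \<open>\<sigma>\<close> with \<open>N - \<Sum>\<^sub># \<sigma> < n\<^sub>0\<close> is sent to a remainder with
  \<open>N - \<Sum>\<^sub># \<sigma> \<ge> R\<close> by removing either one part of size at least \<open>R\<close> or just enough copies
  of a smaller part \<open>w\<close>. To invert the map it suffices to know \<open>N - \<Sum>\<^sub># \<sigma>\<close> in the first
  case and \<open>w\<close> in the second, so its fibres have at most \<open>n\<^sub>0 + R\<close> elements.\<close>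

lemma sum_parts_in_nonneg:
  fixes g :: "nat \<Rightarrow> real" and \<delta> :: real
  assumes A: "0 \<notin> A" and R: "n\<^sub>0 \<le> R" "0 < R" and N: "R ^ 2 + n\<^sub>0 \<le> N" and \<delta>: "0 \<le> \<delta>"
    and lower: "\<And>n. - \<delta> \<le> g n" and nonneg: "\<And>n. n\<^sub>0 \<le> n \<Longrightarrow> 0 \<le> g n"
    and large: "\<And>n. R \<le> n \<Longrightarrow> real (n\<^sub>0 + R) * \<delta> \<le> g n"
  shows "0 \<le> (\<Sum>\<sigma> | \<sigma> \<in> parts_in A \<and> \<Sum>\<^sub># \<sigma> \<le> N. g (N - \<Sum>\<^sub># \<sigma>))"
proof -
  define S where "S = {\<sigma> \<in> parts_in A. \<Sum>\<^sub># \<sigma> \<le> N}"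
  define bad where "bad = {\<sigma> \<in> S. N - \<Sum>\<^sub># \<sigma> < n\<^sub>0}"
  define c where "c w = (LEAST c. R \<le> c * w)" for w
  have fin: "finite S" unfolding S_def by (rule finite_parts_in_sum_le[OF A])
  \<comment> \<open>The label \<open>l\<close> encodes the case: a value below
    \<open>n\<^sub>0\<close> records N - sum \<sigma> when one large part is removed, and
    \<open>n\<^sub>0 + w\<close> records the small part whose copies are removed. The number
    \<open>c w\<close> of copies depends on \<open>w\<close> alone.\<close>
  have "\<exists>w m l. m \<le> count \<sigma> w \<and> R \<le> m * w \<and> l < n\<^sub>0 + R \<and>
      (if l < n\<^sub>0 then m = 1 \<and> N - \<Sum>\<^sub># \<sigma> = l else w = l - n\<^sub>0 \<and> m = c w)" if \<sigma>: "\<sigma> \<in> bad" for \<sigma>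
  proof (cases "\<exists>w \<in># \<sigma>. R \<le> w")
    case True
    then obtain w where "w \<in># \<sigma>" "R \<le> w" by blast
    with \<sigma> show ?thesis
      by (intro exI[of _ w] exI[of _ 1] exI[of _ "N - \<Sum>\<^sub># \<sigma>"])
        (auto simp: bad_def simp del: One_nat_def intro!: Suc_leI)
  next
    case False
    moreover have "R ^ 2 < \<Sum>\<^sub># \<sigma>" using \<sigma> N by (auto simp: bad_def)
    ultimately obtain w where w: "w \<in># \<sigma>" "R \<le> count \<sigma> w * w"
      using exists_heavy_part[of \<sigma> R] by (metis not_le)
    have "c w \<le> count \<sigma> w" "R \<le> c w * w"
      unfolding c_def using w(2) by (rule Least_le, rule LeastI)
    moreover have "w < R" using False w(1) by auto
    ultimately show ?thesis
      by (intro exI[of _ w] exI[of _ "c w"] exI[of _ "n\<^sub>0 + w"]) auto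
  qed
  then obtain w m l where wml: "\<And>\<sigma>. \<sigma> \<in> bad \<Longrightarrow> m \<sigma> \<le> count \<sigma> (w \<sigma>) \<and> R \<le> m \<sigma> * w \<sigma> \<and>
      l \<sigma> < n\<^sub>0 + R \<and> (if l \<sigma> < n\<^sub>0 then m \<sigma> = 1 \<and> N - \<Sum>\<^sub># \<sigma> = l \<sigma>
        else w \<sigma> = l \<sigma> - n\<^sub>0 \<and> m \<sigma> = c (w \<sigma>))"
    by metis
  define \<phi> where "\<phi> \<sigma> = \<sigma> - replicate_mset (m \<sigma>) (w \<sigma>)" for \<sigma>
  have \<phi>: "\<sigma> = \<phi> \<sigma> + replicate_mset (m \<sigma>) (w \<sigma>)" if "\<sigma> \<in> bad" for \<sigma>
    using wml[OF that] unfolding \<phi>_def by (simp add: count_le_replicate_mset_subset_eq)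
  have sum\<phi>: "\<Sum>\<^sub># \<sigma> = \<Sum>\<^sub># (\<phi> \<sigma>) + m \<sigma> * w \<sigma>" if "\<sigma> \<in> bad" for \<sigma>
    using arg_cong[OF \<phi>[OF that], of sum_mset] by simp
  have S\<phi>: "\<phi> \<sigma> \<in> S" "R \<le> N - \<Sum>\<^sub># (\<phi> \<sigma>)" if "\<sigma> \<in> bad" for \<sigma>
  proof -
    have "set_mset (\<phi> \<sigma>) \<subseteq> set_mset \<sigma>" unfolding \<phi>_def by (auto dest: in_diffD)
    then show "\<phi> \<sigma> \<in> S" using that sum\<phi>[OF that] by (auto simp: bad_def S_def parts_in_def)
    show "R \<le> N - \<Sum>\<^sub># (\<phi> \<sigma>)"
      using sum\<phi>[OF that] wml[OF that] that by (auto simp: bad_def S_def)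
  qed
  have "inj_on (\<lambda>\<sigma>. (\<phi> \<sigma>, l \<sigma>)) bad"
  proof (rule inj_onI, clarify)
    fix \<sigma> \<sigma>' assume \<sigma>: "\<sigma> \<in> bad" "\<sigma>' \<in> bad" "\<phi> \<sigma> = \<phi> \<sigma>'" "l \<sigma> = l \<sigma>'"
    have "m \<sigma> = m \<sigma>' \<and> w \<sigma> = w \<sigma>'"
    proof (cases "l \<sigma> < n\<^sub>0")
      case True
      then have 1: "m \<sigma> = 1" "m \<sigma>' = 1" "N - \<Sum>\<^sub># \<sigma> = N - \<Sum>\<^sub># \<sigma>'"
        using wml[OF \<sigma>(1)] wml[OF \<sigma>(2)] \<sigma>(4) by auto
      moreover have "\<Sum>\<^sub># \<sigma> \<le> N" "\<Sum>\<^sub># \<sigma>' \<le> N" using \<sigma> by (auto simp: bad_def S_def)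
      ultimately have "\<Sum>\<^sub># \<sigma> = \<Sum>\<^sub># \<sigma>'" by linarith
      \<comment> \<open>The single removed part is the difference between sum \<sigma>, known from
        the label, and the sum of the image.\<close>
      then show ?thesis using sum\<phi>[OF \<sigma>(1)] sum\<phi>[OF \<sigma>(2)] \<sigma>(3) 1 by simp
    next
      case False
      then show ?thesis using wml[OF \<sigma>(1)] wml[OF \<sigma>(2)] \<sigma>(4) by auto
    qed
    then show "\<sigma> = \<sigma>'" using \<phi>[OF \<sigma>(1)] \<phi>[OF \<sigma>(2)] \<sigma>(3) by metis
  qed
  moreover have "(\<lambda>\<sigma>. (\<phi> \<sigma>, l \<sigma>)) ` bad \<subseteq> \<phi> ` bad \<times> {..<n\<^sub>0 + R}"
    using wml by auto
  moreover have finb: "finite bad" using fin by (auto simp: bad_def)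
  ultimately have "card bad \<le> card (\<phi> ` bad \<times> {..<n\<^sub>0 + R})"
    by (intro card_inj_on_le[of "\<lambda>\<sigma>. (\<phi> \<sigma>, l \<sigma>)"]) auto
  then have "real (card bad) \<le> real (card (\<phi> ` bad)) * real (n\<^sub>0 + R)"
    by (simp only: card_cartesian_product card_lessThan flip: of_nat_mult of_nat_le_iff)
  then have "real (card bad) * \<delta> \<le> real (card (\<phi> ` bad)) * real (n\<^sub>0 + R) * \<delta>"
    using \<delta> by (rule mult_right_mono)
  \<comment> \<open>Each image has a surplus that pays for up to \<open>n\<^sub>0 + R\<close>
    preimages, each losing at most \<delta>.\<close>
  moreover have "real (card (\<phi> ` bad)) * (real (n\<^sub>0 + R) * \<delta>) \<le> (\<Sum>\<sigma>\<in>\<phi> ` bad. g (N - \<Sum>\<^sub># \<sigma>))"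
    using S\<phi>(2) large by (intro sum_bounded_below) auto
  moreover have "real (card bad) * - \<delta> \<le> (\<Sum>\<sigma>\<in>bad. g (N - \<Sum>\<^sub># \<sigma>))"
    using lower by (intro sum_bounded_below) auto
  ultimately have "0 \<le> (\<Sum>\<sigma>\<in>bad. g (N - \<Sum>\<^sub># \<sigma>)) + (\<Sum>\<sigma>\<in>\<phi> ` bad. g (N - \<Sum>\<^sub># \<sigma>))"
    by (simp add: mult.assoc)
  also have "\<dots> = (\<Sum>\<sigma>\<in>bad \<union> \<phi> ` bad. g (N - \<Sum>\<^sub># \<sigma>))"
  proof (rule sum.union_disjoint[symmetric])
    show "bad \<inter> \<phi> ` bad = {}"
      using S\<phi>(2) R(1) unfolding bad_def by fastforce
  qed (use finb in auto)
  also have "\<dots> \<le> (\<Sum>\<sigma>\<in>S. g (N - \<Sum>\<^sub># \<sigma>))"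
    using fin S\<phi>(1) by (intro sum_mono2 nonneg) (auto simp: bad_def)
  finally show ?thesis unfolding S_def by simp
qed

section \<open>The gap polynomial for one remainder\<close>

text \<open>Over the common denominator 4s(s + 1)a(a + 1) the leading coefficients are 2s + 2 on the
  I-side and 2s + 1 on the D-side, which leaves n^2. All errors are expressed through sE: the linear
  one is 28 = 12 + 16, with 12 from the D-side and 16 from the I-side.\<close>

lemma card_gap_consecutive:
  fixes s t a n E :: nat and V :: "nat set"
  assumes V: "finite V" "card V = t" "t > 0" "\<And>k. k \<in> V \<Longrightarrow> s < k"
    and a: "0 < s" "s < a" "a \<notin> V" "a + 1 \<notin> V"
    and E: "(s + 1) * (t * (2 * s + 1)) ^ t \<le> E" "a * (a + 1) \<le> E"
  shows "n ^ 2 + 4 * s * (s + 1) * (a * (a + 1)) *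
      card {\<pi>. \<exists>\<tau>\<in>power_parts t V. \<exists>\<rho>\<in>parts_in {a, a + 1}. \<pi> = \<tau> + \<rho> \<and> \<Sum>\<^sub># \<pi> = n}
    \<le> 4 * s * (s + 1) * (a * (a + 1)) *
      card {\<pi>. \<exists>x\<in>{replicate_mset m s | m. m \<ge> 1}. \<exists>\<rho>\<in>parts_in {a, a + 1}.
        \<pi> = x + \<rho> \<and> \<Sum>\<^sub># \<pi> = n} + 28 * (s * E) * n + 6 * (s * E) ^ 2"
    (is "_ + _ * card ?D \<le> _ * card ?I + _ + _")
proof -
  define x\<^sub>0 where "x\<^sub>0 = (s + 1) * (t * (2 * s + 1)) ^ t"
  define P where "P = a * (a + 1)"
  have "s \<le> a * 1" using a by simp
  also have "\<dots> \<le> P" unfolding P_def by (rule mult_le_mono2) simp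
  finally have le: "s \<le> E" "P \<le> E" "x\<^sub>0 \<le> E" using E unfolding P_def x\<^sub>0_def by simp_all
  have "4 * s * (s + 1) * P * card ?D
      \<le> (2 * s + 1) * (n ^ 2 + 2 * x\<^sub>0 * n + 2 * P * n + 2 * P * x\<^sub>0)"
    unfolding P_def x\<^sub>0_def by (rule card_power_parts_consecutive_le) (use V a in auto)
  also have "\<dots> \<le> (2 * s + 1) * (n ^ 2 + 2 * E * n + 2 * E * n + 2 * E * E)"
    by (intro mult_le_mono2 add_mono mult_le_mono mult_le_mono1 le order_refl)
  also have "\<dots> = (2 * s + 1) * n ^ 2 + (2 * s + 1) * (4 * E * n + 2 * E * E)"
    by (simp add: algebra_simps)
  also have "\<dots> \<le> (2 * s + 1) * n ^ 2 + 3 * s * (4 * E * n + 2 * E * E)"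
    using a by (intro add_left_mono mult_le_mono1) simp
  also have "\<dots> \<le> (2 * s + 1) * n ^ 2 + (12 * (s * E) * n + 6 * (s * E) ^ 2)"
    using a by (simp add: algebra_simps power2_eq_square)
  finally have D: "4 * s * (s + 1) * P * card ?D
      \<le> (2 * s + 1) * n ^ 2 + (12 * (s * E) * n + 6 * (s * E) ^ 2)" .
  have "n ^ 2 \<le> 2 * s * P * card ?I + 2 * n * (P + s)"
    unfolding P_def using a by (intro card_copies_consecutive_ge) auto
  then have "2 * (s + 1) * n ^ 2 \<le> 2 * (s + 1) * (2 * s * P * card ?I + 2 * n * (P + s))"
    by (rule mult_le_mono2)
  also have "\<dots> = 2 * (s + 1) * (2 * s * P * card ?I) + 4 * (s + 1) * n * (P + s)"
    by (simp add: algebra_simps)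
  also have "2 * (s + 1) * (2 * s * P * card ?I) = 4 * s * (s + 1) * P * card ?I"
    by (simp add: algebra_simps)
  also have "4 * (s + 1) * n * (P + s) \<le> 4 * (2 * s) * n * (2 * E)"
    using le a by (intro mult_le_mono) auto
  finally have I: "2 * (s + 1) * n ^ 2 \<le> 4 * s * (s + 1) * P * card ?I + 16 * (s * E) * n"
    by (simp add: algebra_simps)
  have "2 * (s + 1) * n ^ 2 = n ^ 2 + (2 * s + 1) * n ^ 2" by (simp add: algebra_simps)
  then show ?thesis unfolding P_def[symmetric] using D I by linarith
qed

section \<open>Decomposition of the partitions\<close>

text \<open>The t + 1 pairs s + 1 + 2i, s + 2 + 2i with i <= t are disjoint, so the t elements of V
  cannot meet all of them.\<close>

lemma exists_consecutive_pair_avoiding: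
  fixes V :: "nat set"
  assumes "finite V" "card V = t"
  obtains a where "s < a" "a \<le> s + 2 * t + 1" "a \<notin> V" "a + 1 \<notin> V"
proof -
  have "\<exists>i\<le>t. s + 1 + 2 * i \<notin> V \<and> s + 2 + 2 * i \<notin> V"
  proof (rule ccontr)
    assume none: "\<not> ?thesis"
    define f where "f i = (if s + 1 + 2 * i \<in> V then s + 1 + 2 * i else s + 2 + 2 * i)" for i
    have "inj_on f {..t}"
    proof (rule inj_onI)
      fix i j assume "f i = f j"
      then show "i = j" unfolding f_def by (simp split: if_splits; presburger)
    qed
    moreover have "f ` {..t} \<subseteq> V" using none by (auto simp: f_def)
    ultimately have "card {..t} \<le> card V" using assms(1) by (rule card_inj_on_le)
    then show False using assms(2) by simp
  qed
  then obtain i where "i \<le> t" "s + 1 + 2 * i \<notin> V" "s + 2 + 2 * i \<notin> V" by blast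
  then show ?thesis by (intro that[of "s + 1 + 2 * i"]) auto
qed

text \<open>The nested form is the one that \<open>card_sum_split\<close> expects. N > 0 excludes
  the empty multiset, which is a sum of the right-hand form but not in
  \<open>D_parts\<close>.\<close>

lemma D_parts_eq_sums:
  assumes V: "V \<subseteq> {s+1..L+s}" "card V = t" "t > 0"
    and a: "s < a" "a + 1 \<le> L + s" "a \<notin> V" "a + 1 \<notin> V" and N: "N > 0"
  shows "{\<pi> \<in> D_parts L s V. \<Sum>\<^sub># \<pi> = N} =
    {\<pi>. \<exists>\<sigma>\<in>parts_in ({s+1..L+s} - V - {a, a + 1}).
      \<exists>y\<in>{\<pi>. \<exists>\<tau>\<in>power_parts t V. \<exists>\<rho>\<in>parts_in {a, a + 1}. \<pi> = \<tau> + \<rho>}. \<pi> = \<sigma> + y \<and> \<Sum>\<^sub># \<pi> = N}"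
    (is "?L = ?R")
proof
  show "?L \<subseteq> ?R"
  proof
    fix \<pi> assume "\<pi> \<in> ?L"
    then have \<pi>: "set_mset \<pi> \<subseteq> {s+1..L+s}" "\<forall>k\<in>V. is_nth_power t (count \<pi> k)" "\<Sum>\<^sub># \<pi> = N"
      using V by (auto simp: D_parts_def)
    define f where "f A = filter_mset (\<lambda>k. k \<in> A) \<pi>" for A
    have "\<pi> = f ({s+1..L+s} - V - {a, a + 1}) + (f V + f {a, a + 1})"
    proof (rule multiset_eqI)
      fix k
      show "count \<pi> k = count (f ({s+1..L+s} - V - {a, a + 1}) + (f V + f {a, a + 1})) k"
        using \<pi>(1) a by (cases "k \<in># \<pi>") (auto simp: f_def not_in_iff)
    qed
    moreover have "f A \<in> parts_in A" for A by (auto simp: f_def parts_in_def)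
    moreover from this have "f V \<in> power_parts t V"
      using \<pi>(2) by (simp add: power_parts_def) (simp add: f_def)
    ultimately show "\<pi> \<in> ?R" using \<pi>(3) by blast
  qed
  show "?R \<subseteq> ?L"
  proof safe
    fix \<sigma> \<tau> \<rho> assume *: "\<sigma> \<in> parts_in ({s+1..L+s} - V - {a, a + 1})"
      "\<tau> \<in> power_parts t V" "\<rho> \<in> parts_in {a, a + 1}" "N = \<Sum>\<^sub># (\<sigma> + (\<tau> + \<rho>))"
    have "set_mset (\<sigma> + (\<tau> + \<rho>)) \<subseteq> {s+1..L+s}"
      using * V(1) a by (fastforce simp: parts_in_def power_parts_def)
    moreover have "count (\<sigma> + (\<tau> + \<rho>)) k = count \<tau> k" if "k \<in> V" for k
    proof -
      have "k \<notin># \<sigma>" "k \<notin># \<rho>" using * a that by (auto simp: parts_in_def)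
      then show ?thesis by (simp add: not_in_iff)
    qed
    moreover have "\<sigma> + (\<tau> + \<rho>) \<noteq> {#}" using *(4) N by auto
    ultimately show "\<sigma> + (\<tau> + \<rho>) \<in> D_parts L s V"
      using *(2) V(2) by (fastforce simp: D_parts_def is_partition_def power_parts_def)
  qed
qed

text \<open>The condition m >= 1 encodes that s is the smallest part, as all other allowed parts
  exceed s.\<close>

lemma I_parts_eq_sums:
  assumes a: "s < a" "a + 1 \<le> L + s" "a \<notin> V" "a + 1 \<notin> V" and V: "V \<subseteq> {s+1..L+s}" and s: "s > 0"
  shows "{\<pi> \<in> I_parts L s V. \<Sum>\<^sub># \<pi> = N} =
    {\<pi>. \<exists>\<sigma>\<in>parts_in ({s+1..L+s} - V - {a, a + 1}).
      \<exists>y\<in>{\<pi>. \<exists>x\<in>{replicate_mset m s | m. m \<ge> 1}. \<exists>\<rho>\<in>parts_in {a, a + 1}. \<pi> = x + \<rho>}.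
        \<pi> = \<sigma> + y \<and> \<Sum>\<^sub># \<pi> = N}"
    (is "?L = ?R")
proof
  show "?L \<subseteq> ?R"
  proof
    fix \<pi> assume "\<pi> \<in> ?L"
    then have \<pi>: "\<pi> \<noteq> {#}" "Min (set_mset \<pi>) = s" "\<forall>k \<in># \<pi>. k \<le> L + s" "\<forall>k \<in> V. k \<notin># \<pi>"
      "\<Sum>\<^sub># \<pi> = N"
      by (auto simp: I_parts_def)
    have s_in: "s \<in># \<pi>" using \<pi>(1,2) Min_in[of "set_mset \<pi>"] by simp
    have s_le: "s \<le> k" if "k \<in># \<pi>" for k using \<pi>(2) that Min_le[of "set_mset \<pi>" k] by simp
    define f where "f A = filter_mset (\<lambda>k. k \<in> A) \<pi>" for A
    have "\<pi> = f ({s+1..L+s} - V - {a, a + 1}) + (replicate_mset (count \<pi> s) s + f {a, a + 1})"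
    proof (rule multiset_eqI)
      fix k
      show "count \<pi> k =
        count (f ({s+1..L+s} - V - {a, a + 1}) + (replicate_mset (count \<pi> s) s + f {a, a + 1})) k"
        using \<pi>(3,4) s_le[of k] a by (cases "k \<in># \<pi>") (auto simp: f_def not_in_iff)
    qed
    moreover have "f A \<in> parts_in A" for A by (auto simp: f_def parts_in_def)
    moreover have "count \<pi> s \<ge> 1" using s_in by (simp add: Suc_le_eq)
    ultimately show "\<pi> \<in> ?R" using \<pi>(5) by blast
  qed
  show "?R \<subseteq> ?L"
  proof safe
    fix \<sigma> \<rho> :: "nat multiset" and m :: nat
    assume *: "\<sigma> \<in> parts_in ({s+1..L+s} - V - {a, a + 1})" "\<rho> \<in> parts_in {a, a + 1}" "1 \<le> m"
    let ?\<pi> = "\<sigma> + (replicate_mset m s + \<rho>)"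
    have s_in: "s \<in># ?\<pi>" using *(3) by simp
    have bounds: "s \<le> k \<and> k \<le> L + s \<and> k \<notin> V" if "k \<in># ?\<pi>" for k
      using that * a V by (auto simp: parts_in_def split: if_splits)
    have "Min (set_mset ?\<pi>) = s"
      using s_in bounds by (intro Min_eqI) auto
    moreover have "?\<pi> \<noteq> {#}" using s_in by auto
    ultimately show "?\<pi> \<in> I_parts L s V"
      using bounds s unfolding I_parts_def is_partition_def by fastforce
  qed
qed

section \<open>Numerical estimates for the gap polynomial and the threshold\<close>

text \<open>These are the three conditions of \<open>sum_parts_in_nonneg\<close> for \<delta> =
  202e^2, \<open>n\<^sub>0\<close> = 29e and R = 600e^2. The minimum, at n = 14e, is -196e^2 -
  6e^2.\<close>

lemma quadratic_gap_bounds: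
  fixes e n :: real
  assumes e: "1 \<le> e" and n: "0 \<le> n"
  shows "- 202 * e\<^sup>2 \<le> n\<^sup>2 - 28 * e * n - 6 * e\<^sup>2"
    and "29 * e \<le> n \<Longrightarrow> 0 \<le> n\<^sup>2 - 28 * e * n - 6 * e\<^sup>2"
    and "600 * e\<^sup>2 \<le> n \<Longrightarrow> (29 * e + 600 * e\<^sup>2) * (202 * e\<^sup>2) \<le> n\<^sup>2 - 28 * e * n - 6 * e\<^sup>2"
proof -
  have "0 \<le> (n - 14 * e)\<^sup>2" by simp
  then show "- 202 * e\<^sup>2 \<le> n\<^sup>2 - 28 * e * n - 6 * e\<^sup>2"
    by (simp add: power2_eq_square algebra_simps)
  have eq: "n\<^sup>2 - 28 * e * n - 6 * e\<^sup>2 = n * (n - 28 * e) - 6 * e\<^sup>2"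
    by (simp add: power2_eq_square algebra_simps)
  {
    assume "29 * e \<le> n"
    then have "(29 * e) * e \<le> n * (n - 28 * e)" using e by (intro mult_mono) auto
    moreover have "(29 * e) * e - 6 * e\<^sup>2 = 23 * e\<^sup>2" by (simp add: power2_eq_square)
    moreover have "0 \<le> e\<^sup>2" by simp
    ultimately show "0 \<le> n\<^sup>2 - 28 * e * n - 6 * e\<^sup>2" unfolding eq by linarith
  next
    assume le: "600 * e\<^sup>2 \<le> n"
    \<comment> \<open>From e <= e^2 follows n - 28e >= 572e^2, and 600 * 572 is larger than 629 *
      202 + 6.\<close>
    have ee: "e \<le> e\<^sup>2" using e by (simp add: self_le_power)
    then have "(600 * e\<^sup>2) * (572 * e\<^sup>2) \<le> n * (n - 28 * e)"
      using e le by (intro mult_mono) auto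
    moreover have "(29 * e + 600 * e\<^sup>2) * (202 * e\<^sup>2) \<le> (629 * e\<^sup>2) * (202 * e\<^sup>2)"
      using e ee by (intro mult_right_mono) auto
    moreover have "1 * e\<^sup>2 \<le> e\<^sup>2 * e\<^sup>2" using e by (intro mult_right_mono) auto
    moreover have "0 \<le> e\<^sup>2" by simp
    ultimately show "(29 * e + 600 * e\<^sup>2) * (202 * e\<^sup>2) \<le> n\<^sup>2 - 28 * e * n - 6 * e\<^sup>2"
      unfolding eq
        mult.assoc[of _ "e\<^sup>2"] mult.left_commute[of "e\<^sup>2"] by linarith
  }
qed

text \<open>The first two bounds let E serve in \<open>card_gap_consecutive\<close>; the third shows
  that the assumed threshold for N is at least R^2 + \<open>n\<^sub>0\<close>.\<close>

lemma parameter_bounds: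
  fixes s t a E :: nat
  defines "E \<equiv> (39 * s ^ 2 * t ^ 3) ^ t"
  assumes "0 < s" "0 < t"
  shows "(s + 1) * (t * (2 * s + 1)) ^ t \<le> E"
    and "a \<le> s + 2 * t + 1 \<Longrightarrow> a * (a + 1) \<le> E"
    and "(600 * (s * E) ^ 2) ^ 2 + 29 * (s * E)
      \<le> (10 * s) ^ 5 * (t + 1) ^ 4 * (39 * s ^ 2 * t ^ 3) ^ (5 * t)"
proof -
  have st: "s \<le> s * t" "t \<le> s * t" "1 \<le> s * t" using assms by auto
  have t13: "t ^ 1 \<le> t ^ 3" "t ^ 2 \<le> t ^ 3" using assms by (intro power_increasing; simp)+
  \<comment> \<open>Replacing s + 1 by (2s)^t brings everything under one t-th power with base 2s *
    3st = 6s^2 t.\<close>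
  have "s + 1 \<le> (2 * s) ^ 1" using assms by simp
  also have "\<dots> \<le> (2 * s) ^ t" using assms by (intro power_increasing) auto
  finally have "(s + 1) * (t * (2 * s + 1)) ^ t \<le> (2 * s) ^ t * (t * (3 * s)) ^ t"
    using assms by (intro mult_le_mono power_mono) auto
  also have "\<dots> = (6 * s ^ 2 * t ^ 1) ^ t"
    unfolding power_mult_distrib[symmetric] by (simp add: power2_eq_square ac_simps)
  also have "\<dots> \<le> E" unfolding E_def using t13(1) by (intro power_mono mult_le_mono) auto
  finally show "(s + 1) * (t * (2 * s + 1)) ^ t \<le> E" .
  have base: "39 * s ^ 2 * t ^ 3 \<le> E"
    unfolding E_def using assms by (intro self_le_power) auto
  {
    assume "a \<le> s + 2 * t + 1"
    then have "a \<le> 4 * (s * t)" "a + 1 \<le> 5 * (s * t)" using st by linarith+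
    then have "a * (a + 1) \<le> (4 * (s * t)) * (5 * (s * t))" by (rule mult_le_mono)
    also have "\<dots> = 20 * s ^ 2 * t ^ 2" by (simp add: power2_eq_square)
    also have "\<dots> \<le> 39 * s ^ 2 * t ^ 3" using t13(2) by (intro mult_le_mono) auto
    also note base
    finally show "a * (a + 1) \<le> E" .
  }
  have e: "1 \<le> s * E" using assms by (simp add: E_def Suc_le_eq)
  have "(600 * (s * E) ^ 2) ^ 2 + 29 * (s * E) = 360000 * (s * E) ^ 4 + 29 * (s * E) ^ 1"
    by (simp add: power_mult_distrib flip: power_mult)
  also have "\<dots> \<le> 360000 * (s * E) ^ 5 + 29 * (s * E) ^ 5"
    using e by (intro add_mono mult_le_mono2 power_increasing) auto
  \<comment> \<open>Here 360029 <= 100000 * 2^4; then 2 <= t + 1, and 100000 s^5 = (10s)^5.\<close>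
  also have "\<dots> \<le> 100000 * 2 ^ 4 * (s * E) ^ 5" by simp
  also have "\<dots> \<le> 100000 * (t + 1) ^ 4 * (s * E) ^ 5"
    using assms by (intro mult_le_mono mult_le_mono2 power_mono) auto
  also have "\<dots> = (10 * s) ^ 5 * (t + 1) ^ 4 * E ^ 5"
    by (simp add: power_mult_distrib)
  also have "E ^ 5 = (39 * s ^ 2 * t ^ 3) ^ (5 * t)"
    unfolding E_def by (simp add: mult.commute flip: power_mult)
  finally show "(600 * (s * E) ^ 2) ^ 2 + 29 * (s * E)
      \<le> (10 * s) ^ 5 * (t + 1) ^ 4 * (39 * s ^ 2 * t ^ 3) ^ (5 * t)" .
qed

theorem theorem6:
  fixes L s t N :: nat and V :: "nat set"
  assumes "L > 0" and "s > 0"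
    and "V \<subseteq> {s+1..L+s}" and "V \<noteq> {}"
    and "t = card V" and "real t \<le> (real L - 2) / 2"
    and "N \<ge> (10 * s) ^ 5 * (t + 1) ^ 4 * (39 * s ^ 2 * t ^ 3) ^ (5 * t)"
  shows "card {\<pi> \<in> I_parts L s V. \<Sum>\<^sub># \<pi> = N} \<ge> card {\<pi> \<in> D_parts L s V. \<Sum>\<^sub># \<pi> = N}"
proof -
  have fin: "finite V" using assms(3) by (rule finite_subset) simp
  have t: "0 < t" using assms(4,5) fin by (simp add: card_gt_0_iff)
  have tV: "card V = t" using assms(5) by simp
  have "real (2 * t + 2) \<le> real L" using assms(6) by simp
  then have L: "2 * t + 2 \<le> L" by (simp only: of_nat_le_iff)
  have sV: "s < k" if "k \<in> V" for k using that assms(3) by auto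
  obtain a where a: "s < a" "a \<le> s + 2 * t + 1" "a \<notin> V" "a + 1 \<notin> V"
    using exists_consecutive_pair_avoiding[OF fin tV] .
  \<comment> \<open>The bound on t enters here: a + 1 <= s + 2t + 2 <= L + s makes both
    \<open>a\<close> and \<open>a + 1\<close> admissible parts.\<close>
  have aL: "a + 1 \<le> L + s" using a(2) L by linarith
  define E where "E = (39 * s ^ 2 * t ^ 3) ^ t"
  define e where "e = s * E"
  define K where "K = 4 * s * (s + 1) * (a * (a + 1))"
  define W where "W = {s+1..L+s} - V - {a, a + 1}"
  define DD where "DD = {\<pi>. \<exists>\<tau>\<in>power_parts t V. \<exists>\<rho>\<in>parts_in {a, a + 1}. \<pi> = \<tau> + \<rho>}"
  define II where "II = {\<pi>. \<exists>x\<in>{replicate_mset m s | m. m \<ge> 1}. \<exists>\<rho>\<in>parts_in {a, a + 1}. \<pi> = x + \<rho>}"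
  define d where "d n = card {\<pi> \<in> DD. \<Sum>\<^sub># \<pi> = n}" for n
  define i where "i n = card {\<pi> \<in> II. \<Sum>\<^sub># \<pi> = n}" for n
  note pb = parameter_bounds[OF assms(2) t, folded E_def]
  have e: "1 \<le> e" using assms(2) t by (simp add: e_def E_def Suc_le_eq)
  have N: "(600 * e ^ 2) ^ 2 + 29 * e \<le> N"
    using pb(3) assms(7) unfolding e_def by (rule order_trans)
  have "0 < N" using N e by simp
  have "0 < K" using assms(2) a(1) by (simp add: K_def)
  have "n ^ 2 + K * d n \<le> K * i n + 28 * e * n + 6 * e ^ 2" for n
  proof -
    have "{\<pi> \<in> DD. \<Sum>\<^sub># \<pi> = n} =
        {\<pi>. \<exists>\<tau>\<in>power_parts t V. \<exists>\<rho>\<in>parts_in {a, a + 1}. \<pi> = \<tau> + \<rho> \<and> \<Sum>\<^sub># \<pi> = n}"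
      unfolding DD_def by blast
    moreover have "{\<pi> \<in> II. \<Sum>\<^sub># \<pi> = n} = {\<pi>. \<exists>x\<in>{replicate_mset m s | m. m \<ge> 1}.
        \<exists>\<rho>\<in>parts_in {a, a + 1}. \<pi> = x + \<rho> \<and> \<Sum>\<^sub># \<pi> = n}"
      unfolding II_def by blast
    ultimately show ?thesis
      using card_gap_consecutive[OF fin tV t sV assms(2) a(1,3,4) pb(1) pb(2)[OF a(2)], of n]
      unfolding d_def i_def K_def e_def by simp
  qed
  then have real_le: "real (n ^ 2 + K * d n) \<le> real (K * i n + 28 * e * n + 6 * e ^ 2)" for n
    by (simp only: of_nat_le_iff)
  have gap: "real n ^ 2 - 28 * real e * real n - 6 * real e ^ 2
      \<le> real K * (real (i n) - real (d n))" for n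
    using real_le[of n] by (simp add: algebra_simps)
  have e': "1 \<le> real e" using e by simp
  have "0 \<le> (\<Sum>\<sigma> | \<sigma> \<in> parts_in W \<and> \<Sum>\<^sub># \<sigma> \<le> N.
      real K * (real (i (N - \<Sum>\<^sub># \<sigma>)) - real (d (N - \<Sum>\<^sub># \<sigma>))))"
  proof (rule sum_parts_in_nonneg[where n\<^sub>0 = "29 * e" and R = "600 * e ^ 2" and \<delta> = "202 * real e ^ 2"])
    show "29 * e \<le> 600 * e ^ 2" "0 < 600 * e ^ 2"
      using e self_le_power[of e 2] by auto
    fix n
    show "- (202 * real e ^ 2) \<le> real K * (real (i n) - real (d n))"
      using quadratic_gap_bounds(1)[OF e', of n] gap[of n] by simp
    show "0 \<le> real K * (real (i n) - real (d n))" if "29 * e \<le> n"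
      using quadratic_gap_bounds(2)[OF e', of n] gap[of n] that by simp
    show "real (29 * e + 600 * e ^ 2) * (202 * real e ^ 2) \<le> real K * (real (i n) - real (d n))"
      if "600 * e ^ 2 \<le> n"
    proof -
      have "real (600 * e ^ 2) \<le> real n" using that by (simp only: of_nat_le_iff)
      then show ?thesis using quadratic_gap_bounds(3)[OF e', of n] gap[of n] by simp
    qed
  qed (use N in \<open>auto simp: W_def\<close>)
  also have "\<dots> = real K * (real (\<Sum>\<sigma> | \<sigma> \<in> parts_in W \<and> \<Sum>\<^sub># \<sigma> \<le> N. i (N - \<Sum>\<^sub># \<sigma>))
      - real (\<Sum>\<sigma> | \<sigma> \<in> parts_in W \<and> \<Sum>\<^sub># \<sigma> \<le> N. d (N - \<Sum>\<^sub># \<sigma>)))"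
    by (simp add: sum_distrib_left sum_subtractf right_diff_distrib)
  \<comment> \<open>The parts outside \<open>W\<close> lie in {s, a, a + 1} on the I-side and in V
    together with a, a + 1 on the D-side, so each convolution recombines to the full count.\<close>
  also have "(\<Sum>\<sigma> | \<sigma> \<in> parts_in W \<and> \<Sum>\<^sub># \<sigma> \<le> N. i (N - \<Sum>\<^sub># \<sigma>)) =
      card {\<pi> \<in> I_parts L s V. \<Sum>\<^sub># \<pi> = N}"
    unfolding I_parts_eq_sums[OF a(1) aL a(3,4) assms(3,2), folded W_def II_def] i_def
    by (rule card_sum_split[of W "{s, a, a + 1}", symmetric])
      (use assms(2) a(1) in \<open>auto simp: W_def II_def parts_in_def split: if_splits\<close>)
  also have "(\<Sum>\<sigma> | \<sigma> \<in> parts_in W \<and> \<Sum>\<^sub># \<sigma> \<le> N. d (N - \<Sum>\<^sub># \<sigma>)) =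
      card {\<pi> \<in> D_parts L s V. \<Sum>\<^sub># \<pi> = N}"
    unfolding D_parts_eq_sums[OF assms(3) tV t a(1) aL a(3,4) \<open>0 < N\<close>, folded W_def DD_def] d_def
    by (rule card_sum_split[of W "V \<union> {a, a + 1}", symmetric])
      (use sV a(1) in \<open>auto simp: W_def DD_def power_parts_def parts_in_def\<close>)
  finally show ?thesis
    using \<open>0 < K\<close> by (simp add: zero_le_mult_iff)
qed

end
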